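(* Let $\alpha,\beta,\gamma\in[0,1]$ with $\alpha+\beta>0$ and $\alpha+\gamma>0$. For each $N\ge1$ let $k^\star=k^\star_N\in\{1,\dots,N\}$ be the integer $k$ with $H_{k-1,N}\ge\frac{\alpha+\gamma}{\alpha+\beta}>H_{k,N}$, and let $m=m_N$ be the mean completion time function $$m_N(k)=\sum_{j=\kappa+1}^N\frac{\kappa}{j(j-1)}\,j+N\Big(1-\sum_{j=\kappa+1}^N\frac{\kappa}{j(j-1)}\Big),\qquad \kappa=\max\{k,k^\star_N\},\quad 1\le k\le N.$$ Put $t^\star=\exp\big(-\frac{\alpha+\gamma}{\alpha+\beta}\big)$. Then for every $t\in(0,1]$ and all integers $k=k_N\in\{1,\dots,N\}$ with $k_N/N\to t$, $$\hat m(t):=\lim_{N\to\infty}\frac{m_N(k_N)}{N}=\begin{cases}-t\ln t+t, & t>t^\star,\\ -t^\star\ln t^\star+t^\star, & t\le t^\star,\end{cases}$$ and $$\hat m(0^+)=\Big[1+\frac{\alpha+\gamma}{\alpha+\beta}\Big]\exp\Big(-\frac{\alpha+\gamma}{\alpha+\beta}\Big).$$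
   Context: Notation: $H_{k,N}=\sum_{j=k}^{N-1}\frac1j$ for $1\le k\le N$ (so $H_{N,N}=0$) and $H_{0,N}=+\infty$; $\hat m(0^+)=\lim_{t\to0^+}\hat m(t)$. Interpretation: $N$ applicants appear in uniformly random order, a candidate is an applicant better than all previous ones, and $\frac{k}{j(j-1)}$ is the probability that the first candidate after time $k$ appears at time $j$. $m_N(k)$ is the expected time at which the search ends, given that it is still going on after time $k$, when no candidate is accepted until the threshold $k^\star_N$ and the first candidate afterwards is accepted, the search ending at time $N$ if no such candidate appears. *)

theory Defs
  imports "HOL-Analysis.Analysis"
begin

definition H :: "nat \<Rightarrow> nat \<Rightarrow> ereal" where
  "H k N = (if k = 0 then \<infinity> else ereal (\<Sum>j = k..<N. 1 / real j))"

definition is_threshold :: "real \<Rightarrow> real \<Rightarrow> real \<Rightarrow> nat \<Rightarrow> nat \<Rightarrow> bool" where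
  "is_threshold \<alpha> \<beta> \<gamma> N k \<longleftrightarrow>
     k \<in> {1..N} \<and> H (k - 1) N \<ge> ereal ((\<alpha> + \<gamma>) / (\<alpha> + \<beta>)) \<and> ereal ((\<alpha> + \<gamma>) / (\<alpha> + \<beta>)) > H k N"

text \<open>The description is proper for \<open>N \<ge> 1\<close>; see \<open>ex1_threshold\<close> below.\<close>

definition kstar :: "real \<Rightarrow> real \<Rightarrow> real \<Rightarrow> nat \<Rightarrow> nat" where
  "kstar \<alpha> \<beta> \<gamma> N = (THE k. is_threshold \<alpha> \<beta> \<gamma> N k)"

definition mean_time :: "real \<Rightarrow> real \<Rightarrow> real \<Rightarrow> nat \<Rightarrow> nat \<Rightarrow> real" where
  "mean_time \<alpha> \<beta> \<gamma> N k =
     (let \<kappa> = max k (kstar \<alpha> \<beta> \<gamma> N) in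
       (\<Sum>j = \<kappa> + 1..N. real \<kappa> / (real j * (real j - 1)) * real j)
       + real N * (1 - (\<Sum>j = \<kappa> + 1..N. real \<kappa> / (real j * (real j - 1)))))"

text \<open>Sequences \<open>(k\<^sub>N)\<close> for \<open>N \<ge> 1\<close>; the value at \<open>N = 0\<close> is junk.\<close>

definition time_seq :: "real \<Rightarrow> (nat \<Rightarrow> nat) \<Rightarrow> bool" where
  "time_seq t k \<longleftrightarrow>
     (\<forall>N\<ge>1. k N \<in> {1..N}) \<and> (\<lambda>N. real (k N) / real N) \<longlonglongrightarrow> t"

text \<open>The common limit along all sequences with \<open>k\<^sub>N / N \<longlonglongrightarrow> t\<close>.  For \<open>t \<in> {0<..1}\<close> such
  sequences exist (\<open>ex_time_seq\<close>), so at most one \<open>L\<close> qualifies; that one does is part of the theorem.\<close>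

definition mhat :: "real \<Rightarrow> real \<Rightarrow> real \<Rightarrow> real \<Rightarrow> real" where
  "mhat \<alpha> \<beta> \<gamma> t =
     (THE L. \<forall>k. time_seq t k \<longrightarrow> (\<lambda>N. mean_time \<alpha> \<beta> \<gamma> N (k N) / real N) \<longlonglongrightarrow> L)"

definition tstar :: "real \<Rightarrow> real \<Rightarrow> real \<Rightarrow> real" where
  "tstar \<alpha> \<beta> \<gamma> = exp (- ((\<alpha> + \<gamma>) / (\<alpha> + \<beta>)))"

lemma H_antimono:
  assumes "k \<le> l"
  shows "H l N \<le> H k N"
proof (cases "k = 0")
  case True
  then show ?thesis by (simp add: H_def)
next
  case False
  have "(\<Sum>j = l..<N. 1 / real j) \<le> (\<Sum>j = k..<N. 1 / real j)"
    by (rule sum_mono2) (use assms in auto)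
  then show ?thesis using False assms by (simp add: H_def)
qed

lemma ex1_threshold:
  assumes "\<alpha> + \<beta> > 0" "\<alpha> + \<gamma> > 0" "N \<ge> 1"
  shows "\<exists>!k. is_threshold \<alpha> \<beta> \<gamma> N k"
proof (rule ex_ex1I)
  define r where "r = ereal ((\<alpha> + \<gamma>) / (\<alpha> + \<beta>))"
  define k where "k = (LEAST k. H k N < r)"
  have N: "H N N < r" using assms by (simp add: H_def r_def)
  have k: "H k N < r" unfolding k_def by (rule LeastI[of "\<lambda>k. H k N < r", OF N])
  have "k \<le> N" unfolding k_def by (rule Least_le[of "\<lambda>k. H k N < r", OF N])
  have "k \<noteq> 0" using k by (cases "k = 0") (simp_all add: H_def)
  have "\<not> H (k - 1) N < r"
    unfolding k_def by (rule not_less_Least) (use \<open>k \<noteq> 0\<close> in \<open>simp add: k_def\<close>)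
  then have "is_threshold \<alpha> \<beta> \<gamma> N k"
    using k \<open>k \<le> N\<close> \<open>k \<noteq> 0\<close> by (auto simp: is_threshold_def r_def[symmetric])
  then show "\<exists>k. is_threshold \<alpha> \<beta> \<gamma> N k" ..
next
  fix k l assume kl: "is_threshold \<alpha> \<beta> \<gamma> N k" "is_threshold \<alpha> \<beta> \<gamma> N l"
  have "\<not> a < b" if "is_threshold \<alpha> \<beta> \<gamma> N a" "is_threshold \<alpha> \<beta> \<gamma> N b" for a b
  proof
    assume "a < b"
    then have "H (b - 1) N \<le> H a N" by (intro H_antimono) simp
    with that show False unfolding is_threshold_def by (meson leD le_less_trans)
  qed
  from this[OF kl] this[OF kl(2,1)] show "k = l" by simp
qed

lemma ex_time_seq:
  assumes "t \<in> {0<..1}"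
  shows "\<exists>k. time_seq t k"
proof -
  define k where "k = (\<lambda>N::nat. nat \<lceil>t * real N\<rceil>)"
  have 1: "k N \<in> {1..N}" if "N \<ge> 1" for N
  proof -
    have "0 < t * real N" "t * real N \<le> real N"
      using assms that by (auto simp: mult_left_le_one_le)
    then show ?thesis
      unfolding k_def by (auto simp: ceiling_le_iff nat_le_iff le_nat_iff)
  qed
  have b: "t \<le> real (k N) / real N \<and> real (k N) / real N \<le> t + 1 / real N" if "N \<ge> 1" for N
  proof -
    have "0 \<le> t * real N" using assms by simp
    then have "t * real N \<le> real (k N)" "real (k N) \<le> t * real N + 1"
      unfolding k_def by (linarith)+
    then show ?thesis using that by (simp add: field_simps)
  qed
  have "(\<lambda>N. real (k N) / real N) \<longlonglongrightarrow> t"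
  proof (rule tendsto_sandwich)
    show "\<forall>\<^sub>F N in sequentially. t \<le> real (k N) / real N"
      "\<forall>\<^sub>F N in sequentially. real (k N) / real N \<le> t + 1 / real N"
      using b by (auto simp: eventually_sequentially)
    show "(\<lambda>N. t + 1 / real N) \<longlonglongrightarrow> t"
      using tendsto_add[OF tendsto_const lim_1_over_n, of t] by simp
  qed simp
  with 1 show ?thesis unfolding time_seq_def by blast
qed

end

theory Submission
  imports Defs
begin

text \<open>
  Telescoping turns the mean completion time into \<open>m\<^sub>N(k) = \<kappa> (H\<^sub>\<kappa>\<^sub>,\<^sub>N + 1)\<close>.  Since
  \<open>ln (N/k) \<le> H\<^sub>k\<^sub>,\<^sub>N \<le> ln (N/k) + 1/k\<close>, we have \<open>H\<^sub>k\<^sub>,\<^sub>N \<longrightarrow> - ln s\<close> whenever \<open>k/N \<longrightarrow> s > 0\<close>, and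
  the inequalities defining the threshold squeeze its scaled value to \<open>t\<^sup>\<star> = exp (- (\<alpha> + \<gamma>) / (\<alpha> + \<beta>))\<close>.
  Hence \<open>\<kappa>/N \<longrightarrow> s = max t t\<^sup>\<star>\<close> and \<open>m\<^sub>N(k)/N \<longrightarrow> s (1 - ln s)\<close>.
\<close>

text \<open>Raising \<open>N\<close> from \<open>n\<close> to \<open>n + 1\<close> adds
  \<open>ln (1 + 1/n)\<close> on the left and the larger \<open>1/n\<close> on the right.\<close>

lemma ln_le_harmonic_segment:
  assumes "1 \<le> k" "k \<le> N"
  shows "ln (real N / real k) \<le> (\<Sum>j = k..<N. 1 / real j)"
  using assms(2)
proof (induction N rule: dec_induct)
  case base
  then show ?case using assms by simp
next
  case (step n)
  have n: "0 < real n" "0 < real k" using step assms by simp_all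
  have "ln (real (Suc n) / real k) = ln (real n / real k) + ln (1 + 1 / real n)"
  proof -
    have "1 + 1 / real n = real (Suc n) / real n" using n by (simp add: field_simps)
    then show ?thesis using n by (simp add: ln_div)
  qed
  also have "ln (1 + 1 / real n) \<le> 1 / real n"
    using n by (intro ln_add_one_self_le_self) simp
  finally show ?case using step by simp
qed

text \<open>The term \<open>- 1 / real N\<close> makes the induction close: the increment to be
  checked becomes \<open>1/(n+1) \<le> ln ((n+1)/n)\<close>, whereas \<open>1/n\<close> itself
  exceeds that logarithm.\<close>

lemma harmonic_segment_le_ln:
  assumes "1 \<le> k" "k \<le> N"
  shows "(\<Sum>j = k..<N. 1 / real j) \<le> ln (real N / real k) + 1 / real k - 1 / real N"
  using assms(2)
proof (induction N rule: dec_induct)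
  case base
  then show ?case using assms by simp
next
  case (step n)
  have n: "0 < real n" "0 < real k" using step assms by simp_all
  have "ln (real n / real (Suc n)) \<le> real n / real (Suc n) - 1"
    using n by (intro ln_le_minus_one) simp
  also have "\<dots> = - 1 / real (Suc n)"
    by (simp add: field_simps)
  finally have "1 / real (Suc n) \<le> - ln (real n / real (Suc n))" by simp
  also have "\<dots> = ln (real (Suc n) / real k) - ln (real n / real k)"
    using n by (simp add: ln_div)
  finally show ?case using step by simp
qed

lemma harmonic_segment_tendsto:
  assumes "(\<lambda>N. real (k N) / real N) \<longlonglongrightarrow> s" "s > 0"
    and "\<forall>\<^sub>F N in sequentially. 1 \<le> k N \<and> k N \<le> N"
  shows "(\<lambda>N. \<Sum>j = k N..<N. 1 / real j) \<longlonglongrightarrow> - ln s"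
proof (rule tendsto_sandwich)
  have ln: "(\<lambda>N. - ln (real (k N) / real N)) \<longlonglongrightarrow> - ln s"
    using assms by (intro tendsto_intros) auto
  show "(\<lambda>N. - ln (real (k N) / real N)) \<longlonglongrightarrow> - ln s" by (fact ln)
  \<comment> \<open>This product is the error term \<open>1 / real (k N)\<close>, split into a null
    sequence and a factor that converges because \<open>s > 0\<close>.\<close>
  have "(\<lambda>N. 1 / real N * inverse (real (k N) / real N)) \<longlonglongrightarrow> 0 * inverse s"
    using assms by (intro tendsto_intros lim_1_over_n) auto
  from tendsto_add[OF ln this]
  show "(\<lambda>N. - ln (real (k N) / real N) + 1 / real N * inverse (real (k N) / real N))
      \<longlonglongrightarrow> - ln s" by simp
  show "\<forall>\<^sub>F N in sequentially. - ln (real (k N) / real N) \<le> (\<Sum>j = k N..<N. 1 / real j)"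
    using assms(3)
  proof eventually_elim
    case (elim N)
    then show ?case using ln_le_harmonic_segment[of "k N" N] by (simp add: ln_div)
  qed
  show "\<forall>\<^sub>F N in sequentially. (\<Sum>j = k N..<N. 1 / real j)
      \<le> - ln (real (k N) / real N) + 1 / real N * inverse (real (k N) / real N)"
    using assms(3)
  proof eventually_elim
    case (elim N)
    then have "(\<Sum>j = k N..<N. 1 / real j) \<le> ln (real N / real (k N)) + 1 / real (k N)"
      using harmonic_segment_le_ln[of "k N" N] by (smt (verit) divide_nonneg_nonneg of_nat_0_le_iff)
    then show ?case using elim by (simp add: ln_div inverse_eq_divide)
  qed
qed

lemma is_threshold_kstar:
  assumes "\<alpha> + \<beta> > 0" "\<alpha> + \<gamma> > 0" "N \<ge> 1"
  shows "is_threshold \<alpha> \<beta> \<gamma> N (kstar \<alpha> \<beta> \<gamma> N)"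
  unfolding kstar_def by (rule theI') (rule ex1_threshold[OF assms])

lemma is_threshold_lower:
  assumes "is_threshold \<alpha> \<beta> \<gamma> N k"
  shows "tstar \<alpha> \<beta> \<gamma> * real N \<le> real k"
proof -
  let ?r = "(\<alpha> + \<gamma>) / (\<alpha> + \<beta>)"
  have k: "1 \<le> k" "k \<le> N" and "(\<Sum>j = k..<N. 1 / real j) < ?r"
    using assms by (auto simp: is_threshold_def H_def)
  then have "ln (real N / real k) \<le> ?r"
    using ln_le_harmonic_segment[of k N] by simp
  then have "exp (ln (real N / real k)) \<le> exp ?r" by simp
  then have "real N / real k \<le> exp ?r" using k by simp
  then show ?thesis
    using k by (simp add: tstar_def exp_minus field_simps)
qed

text \<open>The other threshold inequality, read at \<open>k - 1\<close>. Since
  \<open>k \<ge> 2\<close>, \<open>H (k - 1) N\<close> is a finite sum and not the conventional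
  infinity; the factor \<open>exp (1 / (real k - 1))\<close> is the price of the error term in the
  harmonic upper bound.\<close>

lemma is_threshold_upper:
  assumes "is_threshold \<alpha> \<beta> \<gamma> N k" "k \<ge> 2"
  shows "real k - 1 \<le> tstar \<alpha> \<beta> \<gamma> * exp (1 / (real k - 1)) * real N"
proof -
  let ?r = "(\<alpha> + \<gamma>) / (\<alpha> + \<beta>)" and ?x = "real k - 1"
  have k: "1 \<le> k - 1" "k - 1 \<le> N" "real (k - 1) = ?x" "?x > 0"
    and r: "?r \<le> (\<Sum>j = k - 1..<N. 1 / real j)"
    using assms by (auto simp: is_threshold_def H_def split: if_splits)
  note r
  also have "\<dots> \<le> ln (real N / ?x) + 1 / ?x - 1 / real N"
    using harmonic_segment_le_ln[OF k(1,2)] unfolding k(3) .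
  also have "\<dots> \<le> ln (real N / ?x) + 1 / ?x" by simp
  finally have "?r - 1 / ?x \<le> ln (real N / ?x)" by simp
  then have "exp (?r - 1 / ?x) \<le> exp (ln (real N / ?x))" by simp
  then have "exp (?r - 1 / ?x) \<le> real N / ?x"
    using k by simp
  \<comment> \<open>Stated for arbitrary reals, so that \<open>field_simps\<close> treats
    \<open>r\<close> as an atom and not as a quotient.\<close>
  moreover have "x \<le> exp (- r) * exp y * n"
    if "exp (r - y) \<le> n / x" "x > 0" for x y r n :: real
    using that by (simp add: exp_minus exp_diff field_simps)
  ultimately show ?thesis
    using k(4) unfolding tstar_def by blast
qed

text \<open>The lower bound holds for every \<open>N \<ge> 1\<close>. It also forces the threshold
  to infinity, which makes the correction factor in the upper bound tend to 1.\<close>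

lemma kstar_tendsto:
  assumes "\<alpha> + \<beta> > 0" "\<alpha> + \<gamma> > 0"
  shows "(\<lambda>N. real (kstar \<alpha> \<beta> \<gamma> N) / real N) \<longlonglongrightarrow> tstar \<alpha> \<beta> \<gamma>"
proof (rule tendsto_sandwich)
  let ?k = "kstar \<alpha> \<beta> \<gamma>" and ?s = "tstar \<alpha> \<beta> \<gamma>"
  have s: "?s > 0" by (simp add: tstar_def)
  have thr: "\<forall>\<^sub>F N in sequentially. N \<ge> 1 \<and> is_threshold \<alpha> \<beta> \<gamma> N (?k N)"
    using is_threshold_kstar[OF assms] by (auto simp: eventually_sequentially)
  show "(\<lambda>N. ?s) \<longlonglongrightarrow> ?s" by simp
  show "\<forall>\<^sub>F N in sequentially. ?s \<le> real (?k N) / real N"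
    using thr by eventually_elim (simp add: is_threshold_lower pos_le_divide_eq)
  have lin: "filterlim (\<lambda>N. ?s * real N - 1) at_top sequentially"
    using filterlim_tendsto_add_at_top[OF tendsto_const filterlim_tendsto_pos_mult_at_top
        [OF tendsto_const s filterlim_real_sequentially], of "- 1"] by simp
  have "(\<lambda>N. ?s * exp (1 / (?s * real N - 1)) + 1 / real N) \<longlonglongrightarrow> ?s * exp 0 + 0"
    by (intro tendsto_intros lim_1_over_n tendsto_divide_0[OF tendsto_const]
        filterlim_at_top_imp_at_infinity lin)
  then show "(\<lambda>N. ?s * exp (1 / (?s * real N - 1)) + 1 / real N) \<longlonglongrightarrow> ?s" by simp
  have "\<forall>\<^sub>F N in sequentially. 1 \<le> ?s * real N - 1"
    using lin unfolding filterlim_at_top by blast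
  with thr show "\<forall>\<^sub>F N in sequentially.
      real (?k N) / real N \<le> ?s * exp (1 / (?s * real N - 1)) + 1 / real N"
  proof eventually_elim
    case (elim N)
    have low: "?s * real N \<le> real (?k N)" using elim is_threshold_lower by blast
    with elim have "?k N \<ge> 2" by linarith
    then have "real (?k N) - 1 \<le> ?s * exp (1 / (real (?k N) - 1)) * real N"
      using elim is_threshold_upper by blast
    \<comment> \<open>Replacing the threshold in the exponent by its lower bound
      \<open>?s * real N\<close> leaves a bound that depends on \<open>N\<close> alone.\<close>
    also have "\<dots> \<le> ?s * exp (1 / (?s * real N - 1)) * real N"
      using low elim s by (intro mult_right_mono mult_left_mono) (auto intro!: divide_left_mono)
    finally show ?case using elim by (simp add: field_simps)
  qed
qed

text \<open>Each summand is \<open>k/(j-1) - k/j\<close>, so the sum telescopes. The missing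
  \<open>k/N\<close> is the probability that no candidate appears after time
  \<open>k\<close>.\<close>

lemma sum_inverse_consecutive:
  assumes "1 \<le> k" "k \<le> N"
  shows "(\<Sum>j = k + 1..N. real k / (real j * (real j - 1))) = 1 - real k / real N"
  using assms(2)
proof (induction N rule: dec_induct)
  case base
  then show ?case using assms by simp
next
  case (step n)
  then have "real n > 0" using assms by simp
  then have "real k / (real (Suc n) * (real (Suc n) - 1)) = real k / real n - real k / real (Suc n)"
    by (simp add: divide_simps) (simp add: algebra_simps)
  with step show ?case by simp
qed

text \<open>In the first sum the factor \<open>j\<close> cancels, and an index shift gives the
  harmonic segment. The search runs to time \<open>N\<close> with probability
  \<open>\<kappa>/N\<close>, which contributes the summand 1 in the bracket.\<close>

lemma mean_time_eq:
  assumes "\<kappa> = max k (kstar \<alpha> \<beta> \<gamma> N)" "1 \<le> \<kappa>" "\<kappa> \<le> N"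
  shows "mean_time \<alpha> \<beta> \<gamma> N k = real \<kappa> * ((\<Sum>j = \<kappa>..<N. 1 / real j) + 1)"
proof -
  have "(\<Sum>j = \<kappa> + 1..N. real \<kappa> / (real j * (real j - 1)) * real j)
      = (\<Sum>j = \<kappa>..<N. real \<kappa> / (real (Suc j) * (real (Suc j) - 1)) * real (Suc j))"
    unfolding Suc_eq_plus1[symmetric] atLeastLessThanSuc_atLeastAtMost[symmetric]
    by (rule sum.shift_bounds_Suc_ivl)
  also have "\<dots> = real \<kappa> * (\<Sum>j = \<kappa>..<N. 1 / real j)"
    unfolding sum_distrib_left using assms(2) by (intro sum.cong) (auto simp: divide_simps)
  finally have "(\<Sum>j = \<kappa> + 1..N. real \<kappa> / (real j * (real j - 1)) * real j)
      = real \<kappa> * (\<Sum>j = \<kappa>..<N. 1 / real j)" .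
  then show ?thesis
    using assms(2,3) unfolding mean_time_def Let_def assms(1)[symmetric]
    by (simp only: sum_inverse_consecutive) (simp add: field_simps)
qed

lemma mean_time_tendsto:
  assumes "\<alpha> + \<beta> > 0" "\<alpha> + \<gamma> > 0" "time_seq t k"
    and s: "s = max t (tstar \<alpha> \<beta> \<gamma>)"
  shows "(\<lambda>N. mean_time \<alpha> \<beta> \<gamma> N (k N) / real N) \<longlonglongrightarrow> s * (1 - ln s)"
proof -
  define \<kappa> where "\<kappa> = (\<lambda>N. max (k N) (kstar \<alpha> \<beta> \<gamma> N))"
  have bnd: "1 \<le> \<kappa> N \<and> \<kappa> N \<le> N" if "N \<ge> 1" for N
  proof -
    have "k N \<in> {1..N}" "kstar \<alpha> \<beta> \<gamma> N \<in> {1..N}"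
      using is_threshold_kstar[OF assms(1,2) that] assms(3) that
      unfolding is_threshold_def time_seq_def by blast+
    then show ?thesis by (auto simp: \<kappa>_def max_def)
  qed
  have "s > 0" unfolding s by (simp add: tstar_def less_max_iff_disj)
  have "(\<lambda>N. max (real (k N) / real N) (real (kstar \<alpha> \<beta> \<gamma> N) / real N)) \<longlonglongrightarrow> s"
    unfolding s using assms by (intro tendsto_max kstar_tendsto) (auto simp: time_seq_def)
  \<comment> \<open>At \<open>N = 0\<close> both sides are 0, since division by zero yields
    0.\<close>
  moreover have "max (real (k N) / real N) (real (kstar \<alpha> \<beta> \<gamma> N) / real N) = real (\<kappa> N) / real N" for N
    by (cases "N = 0") (auto simp: \<kappa>_def max_def divide_le_cancel)
  ultimately have \<kappa>: "(\<lambda>N. real (\<kappa> N) / real N) \<longlonglongrightarrow> s" by simp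
  have "(\<lambda>N. real (\<kappa> N) / real N * ((\<Sum>j = \<kappa> N..<N. 1 / real j) + 1)) \<longlonglongrightarrow> s * (- ln s + 1)"
    using \<open>s > 0\<close> bnd
    by (intro tendsto_intros \<kappa> harmonic_segment_tendsto) (auto simp: eventually_sequentially)
  moreover have "\<forall>\<^sub>F N in sequentially. real (\<kappa> N) / real N * ((\<Sum>j = \<kappa> N..<N. 1 / real j) + 1)
      = mean_time \<alpha> \<beta> \<gamma> N (k N) / real N"
    using eventually_ge_at_top[of 1]
  proof eventually_elim
    case (elim N)
    have "mean_time \<alpha> \<beta> \<gamma> N (k N) = real (\<kappa> N) * ((\<Sum>j = \<kappa> N..<N. 1 / real j) + 1)"
      using bnd[OF elim] by (intro mean_time_eq) (auto simp: \<kappa>_def)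
    then show ?case by simp
  qed
  ultimately have "(\<lambda>N. mean_time \<alpha> \<beta> \<gamma> N (k N) / real N) \<longlonglongrightarrow> s * (- ln s + 1)"
    by (rule Lim_transform_eventually)
  then show ?thesis by simp
qed

text \<open>The range of \<open>t\<close> provides an admissible sequence; along it, uniqueness of
  limits determines \<open>L\<close>, which would otherwise be unconstrained.\<close>

lemma mhat_eq:
  assumes "\<alpha> + \<beta> > 0" "\<alpha> + \<gamma> > 0" "t \<in> {0<..1}"
    and "s = max t (tstar \<alpha> \<beta> \<gamma>)"
  shows "mhat \<alpha> \<beta> \<gamma> t = s * (1 - ln s)"
  unfolding mhat_def
proof (rule the_equality)
  show "\<forall>k. time_seq t k \<longrightarrow> (\<lambda>N. mean_time \<alpha> \<beta> \<gamma> N (k N) / real N) \<longlonglongrightarrow> s * (1 - ln s)"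
    using mean_time_tendsto[OF assms(1,2) _ assms(4)] by blast
next
  fix L assume L: "\<forall>k. time_seq t k \<longrightarrow> (\<lambda>N. mean_time \<alpha> \<beta> \<gamma> N (k N) / real N) \<longlonglongrightarrow> L"
  obtain k where "time_seq t k" using ex_time_seq[OF assms(3)] by blast
  with L mean_time_tendsto[OF assms(1,2) _ assms(4)] show "L = s * (1 - ln s)"
    using LIMSEQ_unique by blast
qed

theorem corollary3p1:
  fixes \<alpha> \<beta> \<gamma> :: real
  assumes "\<alpha> \<in> {0..1}" and "\<beta> \<in> {0..1}" and "\<gamma> \<in> {0..1}"
    and "\<alpha> + \<beta> > 0" and "\<alpha> + \<gamma> > 0"
  shows "(\<forall>t\<in>{0<..1}.
            (\<forall>k. time_seq t k \<longrightarrow>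
               (\<lambda>N. mean_time \<alpha> \<beta> \<gamma> N (k N) / real N) \<longlonglongrightarrow> mhat \<alpha> \<beta> \<gamma> t) \<and>
            mhat \<alpha> \<beta> \<gamma> t =
              (if t > tstar \<alpha> \<beta> \<gamma> then - t * ln t + t
               else - tstar \<alpha> \<beta> \<gamma> * ln (tstar \<alpha> \<beta> \<gamma>) + tstar \<alpha> \<beta> \<gamma>)) \<and>
         (mhat \<alpha> \<beta> \<gamma> \<longlongrightarrow>
            (1 + (\<alpha> + \<gamma>) / (\<alpha> + \<beta>)) * exp (- ((\<alpha> + \<gamma>) / (\<alpha> + \<beta>)))) (at_right 0)"
proof (intro conjI ballI)
  note pos = assms(4,5)
  let ?s = "tstar \<alpha> \<beta> \<gamma>"
  {
    fix t :: real assume t: "t \<in> {0<..1}"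
    show "\<forall>k. time_seq t k \<longrightarrow>
        (\<lambda>N. mean_time \<alpha> \<beta> \<gamma> N (k N) / real N) \<longlonglongrightarrow> mhat \<alpha> \<beta> \<gamma> t"
      using mean_time_tendsto[OF pos] mhat_eq[OF pos t] by simp
    show "mhat \<alpha> \<beta> \<gamma> t = (if t > ?s then - t * ln t + t else - ?s * ln ?s + ?s)"
      using mhat_eq[OF pos t refl] by (auto simp: max_def algebra_simps)
  }
  have s: "0 < ?s" "?s < 1" using pos by (simp_all add: tstar_def)
  \<comment> \<open>On this interval the maximum is \<open>?s\<close>, so \<open>mhat\<close> is
    constant there; \<open>?s < 1\<close> keeps \<open>t\<close> in the range of
    \<open>mhat_eq\<close>.\<close>
  have "\<forall>\<^sub>F t in at_right 0. t \<in> {0<..<?s}"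
    using s by (intro eventually_at_right_real)
  then have "\<forall>\<^sub>F t in at_right 0. mhat \<alpha> \<beta> \<gamma> t = ?s * (1 - ln ?s)"
    by eventually_elim (use s mhat_eq[OF pos _ refl] in \<open>auto simp: max_def\<close>)
  then have "(mhat \<alpha> \<beta> \<gamma> \<longlongrightarrow> ?s * (1 - ln ?s)) (at_right 0)"
    by (rule tendsto_eventually)
  then show "(mhat \<alpha> \<beta> \<gamma> \<longlongrightarrow>
      (1 + (\<alpha> + \<gamma>) / (\<alpha> + \<beta>)) * exp (- ((\<alpha> + \<gamma>) / (\<alpha> + \<beta>)))) (at_right 0)"
    by (simp add: tstar_def mult.commute)
qed

end
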